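(* (Progress for LDC.) For every type $A$ and every closed term $M:\emptyset\vdash A$ of the LDC calculus, one of the following holds: 1. $M\longrightarrow M'$ for some $M'$; 2. $M$ is a value; 3. $M=\mathtt{blame}\,\ell$ for some blame label $\ell$.
   Context: LDC is a cast calculus with lazy "D" coercions. **Types.** Base types $b$: $\mathtt{Nat},\mathtt{Bool},\mathtt{Int},\mathtt{Unit},\bot$. Types: $A,B::=b\mid\,?\mid A\to B\mid A\times B\mid A+B$; atomic types $a::=b\mid\,?$; $\otimes$ ranges over $\{\to,\times,+\}$. Contexts are finite sequences of types; variables are de Bruijn indices (index $0$ is the last-added type). Primitive types $P::=b\mid b\to P$; each $b$ denotes a set (naturals, Booleans, integers, one-element set, empty set), $[\![b\to P]\!]$ is the set of functions $[\![b]\!]\to[\![P]\!]$. Blame labels range over a fixed set with an involution $\ell\mapsto\overline\ell$. **Casts** are coercions $c,d:A\Rightarrow B$: $\bot^\ell:A\Rightarrow B$ (failure, any $A,B$); $\mathsf{id}:a\Rightarrow a$; $A!:A\Rightarrow\,?$ for $A\ne\,?$; $B?^\ell:\,?\Rightarrow B$ for $B\neq\,?$; $c\to d:(A\to B)\Rightarrow(C\to D)$ for $c:C\Rightarrow A$, $d:B\Rightarrow D$; $c\times d:(A\times B)\Rightarrow(C\times D)$ and $c+d:(A+B)\Rightarrow(C+D)$ for $c:A\Rightarrow C$, $d:B\Rightarrow D$. *Inert*: $A!$. *Active*: all others. *Shallow consistency* $A\smile B$ holds iff $A=\,?$, or $B=\,?$, or $A=B=b$ for a base type $b$, or $A=A_1\otimes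 A_2$ and $B=B_1\otimes B_2$ for the same $\otimes$. $\mathrm{coerce}(A,B,\ell):A\Rightarrow B$ for all $A,B$: it is $\bot^\ell$ if not $A\smile B$; $\mathrm{coerce}(?,?,\ell)=\mathsf{id}$; for $B\ne\,?$, $\mathrm{coerce}(?,B,\ell)=B?^\ell$; for $A\ne\,?$, $\mathrm{coerce}(A,?,\ell)=A!$; $\mathrm{coerce}(b,b,\ell)=\mathsf{id}$; $\mathrm{coerce}(A\to B,C\to D,\ell)=\mathrm{coerce}(C,A,\overline\ell)\to\mathrm{coerce}(B,D,\ell)$; $\mathrm{coerce}(A\otimes B,C\otimes D,\ell)=\mathrm{coerce}(A,C,\ell)\otimes\mathrm{coerce}(B,D,\ell)$ for $\otimes\in\{\times,+\}$. **Terms** (intrinsically typed; $M:\Gamma\vdash A$): $\$k:P$ for $k\in[\![P]\!]$; $`x:A$ if $x$ has type $A$ in $\Gamma$; $\lambda M:A\to B$ if $M:\Gamma\cdot A\vdash B$; $L\,M:B$ if $L:A\to B$, $M:A$; $\mathtt{if}\,L\,M\,N:B$ if $L:\mathtt{Bool}$, $M,N:B$; $\mathtt{cons}\,M\,N:A\times B$; $\pi_iM:A_i$ if $M:A_1\times A_2$; $\mathtt{inl}[B]M:A+B$ if $M:A$; $\mathtt{inr}[A]M:A+B$ if $M:B$; $\mathtt{case}\,L\,M\,N:B$ if $L:A_1+A_2$, $M:A_1\to B$, $N:A_2\to B$; $M\langle c\rangle:B$ if $M:A$, $c:A\Rightarrow B$; $\mathtt{blame}\,\ell:A$ for every $A$.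 **Values** $V,W$: $\lambda M$; $\$k$; $\mathtt{cons}\,V\,W$; $\mathtt{inl}[B]V$; $\mathtt{inr}[A]V$; $V\langle A!\rangle$. **Frames** $F$: $\Box\,M$; $V\,\Box$; $\mathtt{if}\,\Box\,M\,N$; $\mathtt{cons}\,V\,\Box$; $\mathtt{cons}\,\Box\,N$; $\pi_i\Box$; $\mathtt{inl}[B]\Box$; $\mathtt{inr}[A]\Box$; $\mathtt{case}\,\Box\,M\,N$; $\Box\langle c\rangle$. **Reduction** ($M[V]$ is substitution for variable $0$; $\uparrow$ is weakening by one variable): - $F[M]\longrightarrow F[M']$ if $M\longrightarrow M'$; $F[\mathtt{blame}\,\ell]\longrightarrow\mathtt{blame}\,\ell$. - $V\langle\mathsf{id}\rangle\longrightarrow V$; $V\langle A!\rangle\langle B?^\ell\rangle\longrightarrow V\langle\mathrm{coerce}(A,B,\ell)\rangle$; $V\langle\bot^\ell\rangle\longrightarrow\mathtt{blame}\,\ell$. - $V\langle c\to d\rangle\longrightarrow\lambda(((\uparrow V)\,(`0\langle c\rangle))\langle d\rangle)$; $V\langle c\times d\rangle\longrightarrow\mathtt{cons}\,((\pi_1V)\langle c\rangle)\,((\pi_2V)\langle d\rangle)$; $V\langle c+d\rangle\longrightarrow\mathtt{case}\,V\,(\lambda\,\mathtt{inl}[D](`0\langle c\rangle))\,(\lambda\,\mathtt{inr}[C](`0\langle d\rangle))$ where the target of $c+d$ is $C+D$. - $(\lambda M)V\longrightarrow M[V]$; $\mathtt{if}\,\$\mathtt{true}\,M\,N\longrightarrow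 M$; $\mathtt{if}\,\$\mathtt{false}\,M\,N\longrightarrow N$; $\pi_1(\mathtt{cons}\,V\,W)\longrightarrow V$; $\pi_2(\mathtt{cons}\,V\,W)\longrightarrow W$; $\mathtt{case}(\mathtt{inl}[B]V)\,L\,M\longrightarrow L\,V$; $\mathtt{case}(\mathtt{inr}[A]V)\,L\,M\longrightarrow M\,V$; $\$k\,\$k'\longrightarrow\$(k(k'))$. *)

theory Defs
  imports Main "HOL-Library.FuncSet"
begin

section \<open>Types\<close>

datatype base = BNat | BBool | BInt | BUnit | BVoid

datatype ty =
    Base base
  | Dyn
  | Arr ty ty
  | Times ty ty
  | Plus ty ty

fun atomic :: "ty \<Rightarrow> bool" where
  "atomic (Base b) = True"
| "atomic Dyn = True"
| "atomic _ = False"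

text \<open>A context is a list of types whose head is the type added last, so that \<open>A # \<Gamma>\<close> is the
  extension of \<open>\<Gamma>\<close> by \<open>A\<close> and de Bruijn index \<open>x\<close> refers to \<open>\<Gamma> ! x\<close>.\<close>

type_synonym ctx = "ty list"


section \<open>Primitive types and their denotations\<close>

datatype pty = PBase base | PArr base pty

primrec ty_of_pty :: "pty \<Rightarrow> ty" where
  "ty_of_pty (PBase b) = Base b"
| "ty_of_pty (PArr b P) = Arr (Base b) (ty_of_pty P)"

text \<open>The sets denoted by all primitive types live in the single type \<open>pval\<close>.  The function sets
  are extensional (\<open>\<rightarrow>\<^sub>E\<close>), so that elements of \<open>den_pty (PArr b P)\<close> correspond one-to-one to the
  functions from \<open>den_base b\<close> to \<open>den_pty P\<close>.\<close>

datatype bval = NatV nat | BoolV bool | IntV int | UnitV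

datatype pval = BaseV bval | FunV "bval \<Rightarrow> pval"

primrec den_base :: "base \<Rightarrow> bval set" where
  "den_base BNat = range NatV"
| "den_base BBool = range BoolV"
| "den_base BInt = range IntV"
| "den_base BUnit = {UnitV}"
| "den_base BVoid = {}"

primrec den_pty :: "pty \<Rightarrow> pval set" where
  "den_pty (PBase b) = BaseV ` den_base b"
| "den_pty (PArr b P) = FunV ` (den_base b \<rightarrow>\<^sub>E den_pty P)"


section \<open>Blame labels and coercions\<close>

class blame_label =
  fixes flip :: "'a \<Rightarrow> 'a"
  assumes flip_flip: "flip (flip l) = l"

text \<open>Coercions and terms carry enough type annotations to determine their types, so a raw
  coercion or term together with the fact that it is well typed amounts to an intrinsically typed
  one.\<close>

datatype 'l coercion =
    Fail ty ty 'l
  | CId ty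
  | Inj ty
  | Proj ty 'l
  | CArr "'l coercion" "'l coercion"
  | CTimes "'l coercion" "'l coercion"
  | CPlus "'l coercion" "'l coercion"

inductive coercion_typing :: "'l coercion \<Rightarrow> ty \<Rightarrow> ty \<Rightarrow> bool"  ("(\<turnstile>c _ : _ \<Rightarrow> _)" [51, 51, 51] 50)
where
  ct_Fail: "\<turnstile>c Fail A B l : A \<Rightarrow> B"
| ct_Id: "atomic a \<Longrightarrow> \<turnstile>c CId a : a \<Rightarrow> a"
| ct_Inj: "A \<noteq> Dyn \<Longrightarrow> \<turnstile>c Inj A : A \<Rightarrow> Dyn"
| ct_Proj: "B \<noteq> Dyn \<Longrightarrow> \<turnstile>c Proj B l : Dyn \<Rightarrow> B"
| ct_Arr: "\<turnstile>c c : C \<Rightarrow> A \<Longrightarrow> \<turnstile>c d : B \<Rightarrow> D \<Longrightarrow> \<turnstile>c CArr c d : Arr A B \<Rightarrow> Arr C D"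
| ct_Times: "\<turnstile>c c : A \<Rightarrow> C \<Longrightarrow> \<turnstile>c d : B \<Rightarrow> D \<Longrightarrow> \<turnstile>c CTimes c d : Times A B \<Rightarrow> Times C D"
| ct_Plus: "\<turnstile>c c : A \<Rightarrow> C \<Longrightarrow> \<turnstile>c d : B \<Rightarrow> D \<Longrightarrow> \<turnstile>c CPlus c d : Plus A B \<Rightarrow> Plus C D"

inductive shallow_consistent :: "ty \<Rightarrow> ty \<Rightarrow> bool"  (infix "\<smile>" 50) where
  "Dyn \<smile> B"
| "A \<smile> Dyn"
| "Base b \<smile> Base b"
| "Arr A1 A2 \<smile> Arr B1 B2"
| "Times A1 A2 \<smile> Times B1 B2"
| "Plus A1 A2 \<smile> Plus B1 B2"

function (sequential) coerce :: "ty \<Rightarrow> ty \<Rightarrow> 'l :: blame_label \<Rightarrow> 'l coercion" where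
  "coerce Dyn Dyn l = CId Dyn"
| "coerce Dyn B l = Proj B l"
| "coerce A Dyn l = Inj A"
| "coerce (Base b) (Base b') l = (if b = b' then CId (Base b) else Fail (Base b) (Base b') l)"
| "coerce (Arr A B) (Arr C D) l = CArr (coerce C A (flip l)) (coerce B D l)"
| "coerce (Times A B) (Times C D) l = CTimes (coerce A C l) (coerce B D l)"
| "coerce (Plus A B) (Plus C D) l = CPlus (coerce A C l) (coerce B D l)"
| "coerce A B l = Fail A B l"
  by pat_completeness auto
termination by (relation "measure (\<lambda>(A, B, l). size A + size B)") auto

lemma coerce_not_shallow_consistent: "\<not> A \<smile> B \<Longrightarrow> coerce A B l = Fail A B l"
  by (cases "(A, B, l)" rule: coerce.cases) (auto intro: shallow_consistent.intros)

lemma coerce_typing: "\<turnstile>c coerce A B l : A \<Rightarrow> B"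
  by (induction A B l rule: coerce.induct) (auto intro: coercion_typing.intros)


section \<open>Terms\<close>

datatype 'l tm =
    Const pty pval
  | Var nat
  | Lam ty "'l tm"
  | App "'l tm" "'l tm"
  | Ite "'l tm" "'l tm" "'l tm"
  | MkPair "'l tm" "'l tm"
  | Fst "'l tm"
  | Snd "'l tm"
  | InL ty "'l tm"
  | InR ty "'l tm"
  | Case "'l tm" "'l tm" "'l tm"
  | Cast "'l tm" "'l coercion"
  | Blame ty 'l

inductive typing :: "ctx \<Rightarrow> 'l tm \<Rightarrow> ty \<Rightarrow> bool"  ("(_ \<turnstile> _ : _)" [51, 51, 51] 50) where
  t_Const: "k \<in> den_pty P \<Longrightarrow> \<Gamma> \<turnstile> Const P k : ty_of_pty P"
| t_Var: "x < length \<Gamma> \<Longrightarrow> \<Gamma> ! x = A \<Longrightarrow> \<Gamma> \<turnstile> Var x : A"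
| t_Lam: "A # \<Gamma> \<turnstile> M : B \<Longrightarrow> \<Gamma> \<turnstile> Lam A M : Arr A B"
| t_App: "\<Gamma> \<turnstile> L : Arr A B \<Longrightarrow> \<Gamma> \<turnstile> M : A \<Longrightarrow> \<Gamma> \<turnstile> App L M : B"
| t_Ite: "\<Gamma> \<turnstile> L : Base BBool \<Longrightarrow> \<Gamma> \<turnstile> M : B \<Longrightarrow> \<Gamma> \<turnstile> N : B \<Longrightarrow> \<Gamma> \<turnstile> Ite L M N : B"
| t_MkPair: "\<Gamma> \<turnstile> M : A \<Longrightarrow> \<Gamma> \<turnstile> N : B \<Longrightarrow> \<Gamma> \<turnstile> MkPair M N : Times A B"
| t_Fst: "\<Gamma> \<turnstile> M : Times A B \<Longrightarrow> \<Gamma> \<turnstile> Fst M : A"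
| t_Snd: "\<Gamma> \<turnstile> M : Times A B \<Longrightarrow> \<Gamma> \<turnstile> Snd M : B"
| t_InL: "\<Gamma> \<turnstile> M : A \<Longrightarrow> \<Gamma> \<turnstile> InL B M : Plus A B"
| t_InR: "\<Gamma> \<turnstile> M : B \<Longrightarrow> \<Gamma> \<turnstile> InR A M : Plus A B"
| t_Case: "\<Gamma> \<turnstile> L : Plus A1 A2 \<Longrightarrow> \<Gamma> \<turnstile> M : Arr A1 B \<Longrightarrow> \<Gamma> \<turnstile> N : Arr A2 B \<Longrightarrow> \<Gamma> \<turnstile> Case L M N : B"
| t_Cast: "\<Gamma> \<turnstile> M : A \<Longrightarrow> \<turnstile>c c : A \<Rightarrow> B \<Longrightarrow> \<Gamma> \<turnstile> Cast M c : B"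
| t_Blame: "\<Gamma> \<turnstile> Blame A l : A"


section \<open>Renaming and substitution\<close>

definition ext_ren :: "(nat \<Rightarrow> nat) \<Rightarrow> nat \<Rightarrow> nat" where
  "ext_ren \<rho> = case_nat 0 (\<lambda>x. Suc (\<rho> x))"

primrec rename :: "(nat \<Rightarrow> nat) \<Rightarrow> 'l tm \<Rightarrow> 'l tm" where
  "rename \<rho> (Const P k) = Const P k"
| "rename \<rho> (Var x) = Var (\<rho> x)"
| "rename \<rho> (Lam A M) = Lam A (rename (ext_ren \<rho>) M)"
| "rename \<rho> (App L M) = App (rename \<rho> L) (rename \<rho> M)"
| "rename \<rho> (Ite L M N) = Ite (rename \<rho> L) (rename \<rho> M) (rename \<rho> N)"
| "rename \<rho> (MkPair M N) = MkPair (rename \<rho> M) (rename \<rho> N)"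
| "rename \<rho> (Fst M) = Fst (rename \<rho> M)"
| "rename \<rho> (Snd M) = Snd (rename \<rho> M)"
| "rename \<rho> (InL B M) = InL B (rename \<rho> M)"
| "rename \<rho> (InR A M) = InR A (rename \<rho> M)"
| "rename \<rho> (Case L M N) = Case (rename \<rho> L) (rename \<rho> M) (rename \<rho> N)"
| "rename \<rho> (Cast M c) = Cast (rename \<rho> M) c"
| "rename \<rho> (Blame A l) = Blame A l"

abbreviation weaken :: "'l tm \<Rightarrow> 'l tm" where
  "weaken \<equiv> rename Suc"

definition ext_sub :: "(nat \<Rightarrow> 'l tm) \<Rightarrow> nat \<Rightarrow> 'l tm" where
  "ext_sub \<sigma> = case_nat (Var 0) (\<lambda>x. weaken (\<sigma> x))"

primrec subst :: "(nat \<Rightarrow> 'l tm) \<Rightarrow> 'l tm \<Rightarrow> 'l tm" where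
  "subst \<sigma> (Const P k) = Const P k"
| "subst \<sigma> (Var x) = \<sigma> x"
| "subst \<sigma> (Lam A M) = Lam A (subst (ext_sub \<sigma>) M)"
| "subst \<sigma> (App L M) = App (subst \<sigma> L) (subst \<sigma> M)"
| "subst \<sigma> (Ite L M N) = Ite (subst \<sigma> L) (subst \<sigma> M) (subst \<sigma> N)"
| "subst \<sigma> (MkPair M N) = MkPair (subst \<sigma> M) (subst \<sigma> N)"
| "subst \<sigma> (Fst M) = Fst (subst \<sigma> M)"
| "subst \<sigma> (Snd M) = Snd (subst \<sigma> M)"
| "subst \<sigma> (InL B M) = InL B (subst \<sigma> M)"
| "subst \<sigma> (InR A M) = InR A (subst \<sigma> M)"
| "subst \<sigma> (Case L M N) = Case (subst \<sigma> L) (subst \<sigma> M) (subst \<sigma> N)"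
| "subst \<sigma> (Cast M c) = Cast (subst \<sigma> M) c"
| "subst \<sigma> (Blame A l) = Blame A l"

definition subst0 :: "'l tm \<Rightarrow> 'l tm \<Rightarrow> 'l tm" where
  "subst0 M V = subst (case_nat V Var) M"


section \<open>Values, frames and reduction\<close>

inductive val :: "'l tm \<Rightarrow> bool" where
  v_Lam: "val (Lam A M)"
| v_Const: "val (Const P k)"
| v_MkPair: "val V \<Longrightarrow> val W \<Longrightarrow> val (MkPair V W)"
| v_InL: "val V \<Longrightarrow> val (InL B V)"
| v_InR: "val V \<Longrightarrow> val (InR A V)"
| v_Inj: "val V \<Longrightarrow> val (Cast V (Inj A))"

datatype 'l frame =
    FAppL "'l tm"
  | FAppR "'l tm"
  | FIte "'l tm" "'l tm"
  | FMkPairR "'l tm"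
  | FMkPairL "'l tm"
  | FFst
  | FSnd
  | FInL ty
  | FInR ty
  | FCase "'l tm" "'l tm"
  | FCast "'l coercion"

primrec plug :: "'l frame \<Rightarrow> 'l tm \<Rightarrow> 'l tm" where
  "plug (FAppL N) M = App M N"
| "plug (FAppR V) M = App V M"
| "plug (FIte N1 N2) M = Ite M N1 N2"
| "plug (FMkPairR V) M = MkPair V M"
| "plug (FMkPairL N) M = MkPair M N"
| "plug FFst M = Fst M"
| "plug FSnd M = Snd M"
| "plug (FInL B) M = InL B M"
| "plug (FInR A) M = InR A M"
| "plug (FCase N1 N2) M = Case M N1 N2"
| "plug (FCast c) M = Cast M c"

text \<open>\<open>\<Gamma> \<turnstile>f F : A \<Rightarrow> B\<close>: \<open>F\<close> is a frame in context \<open>\<Gamma>\<close> with a hole of type \<open>A\<close> and result type \<open>B\<close>.\<close>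

inductive frame_typing :: "ctx \<Rightarrow> 'l frame \<Rightarrow> ty \<Rightarrow> ty \<Rightarrow> bool"
  ("(_ \<turnstile>f _ : _ \<Rightarrow> _)" [51, 51, 51, 51] 50)
where
  ft_AppL: "\<Gamma> \<turnstile> M : A \<Longrightarrow> \<Gamma> \<turnstile>f FAppL M : Arr A B \<Rightarrow> B"
| ft_AppR: "val V \<Longrightarrow> \<Gamma> \<turnstile> V : Arr A B \<Longrightarrow> \<Gamma> \<turnstile>f FAppR V : A \<Rightarrow> B"
| ft_Ite: "\<Gamma> \<turnstile> M : B \<Longrightarrow> \<Gamma> \<turnstile> N : B \<Longrightarrow> \<Gamma> \<turnstile>f FIte M N : Base BBool \<Rightarrow> B"
| ft_MkPairR: "val V \<Longrightarrow> \<Gamma> \<turnstile> V : A \<Longrightarrow> \<Gamma> \<turnstile>f FMkPairR V : B \<Rightarrow> Times A B"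
| ft_MkPairL: "\<Gamma> \<turnstile> N : B \<Longrightarrow> \<Gamma> \<turnstile>f FMkPairL N : A \<Rightarrow> Times A B"
| ft_Fst: "\<Gamma> \<turnstile>f FFst : Times A B \<Rightarrow> A"
| ft_Snd: "\<Gamma> \<turnstile>f FSnd : Times A B \<Rightarrow> B"
| ft_InL: "\<Gamma> \<turnstile>f FInL B : A \<Rightarrow> Plus A B"
| ft_InR: "\<Gamma> \<turnstile>f FInR A : B \<Rightarrow> Plus A B"
| ft_Case: "\<Gamma> \<turnstile> M : Arr A1 B \<Longrightarrow> \<Gamma> \<turnstile> N : Arr A2 B \<Longrightarrow> \<Gamma> \<turnstile>f FCase M N : Plus A1 A2 \<Rightarrow> B"
| ft_Cast: "\<turnstile>c c : A \<Rightarrow> B \<Longrightarrow> \<Gamma> \<turnstile>f FCast c : A \<Rightarrow> B"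

text \<open>The context and the typing premises below fix the type annotations of the reduct; whether a
  frame position may be reduced depends only on the value conditions in \<open>frame_typing\<close>.\<close>

inductive red :: "ctx \<Rightarrow> 'l :: blame_label tm \<Rightarrow> 'l tm \<Rightarrow> bool"
  ("(_ \<turnstile> _ \<longrightarrow>\<^sub>r _)" [51, 51, 51] 50)
where
  r_frame: "\<Gamma> \<turnstile>f F : A \<Rightarrow> B \<Longrightarrow> \<Gamma> \<turnstile> M \<longrightarrow>\<^sub>r M' \<Longrightarrow> \<Gamma> \<turnstile> plug F M \<longrightarrow>\<^sub>r plug F M'"
| r_blame: "\<Gamma> \<turnstile>f F : A \<Rightarrow> B \<Longrightarrow> \<Gamma> \<turnstile> plug F (Blame A l) \<longrightarrow>\<^sub>r Blame B l"
| r_id: "val V \<Longrightarrow> \<Gamma> \<turnstile> Cast V (CId a) \<longrightarrow>\<^sub>r V"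
| r_proj: "val V \<Longrightarrow> \<Gamma> \<turnstile> Cast (Cast V (Inj A)) (Proj B l) \<longrightarrow>\<^sub>r Cast V (coerce A B l)"
| r_fail: "val V \<Longrightarrow> \<Gamma> \<turnstile> Cast V (Fail A B l) \<longrightarrow>\<^sub>r Blame B l"
| r_arr: "val V \<Longrightarrow> \<turnstile>c c : C \<Rightarrow> A \<Longrightarrow>
    \<Gamma> \<turnstile> Cast V (CArr c d) \<longrightarrow>\<^sub>r Lam C (Cast (App (weaken V) (Cast (Var 0) c)) d)"
| r_times: "val V \<Longrightarrow>
    \<Gamma> \<turnstile> Cast V (CTimes c d) \<longrightarrow>\<^sub>r MkPair (Cast (Fst V) c) (Cast (Snd V) d)"
| r_plus: "val V \<Longrightarrow> \<turnstile>c c : A \<Rightarrow> C \<Longrightarrow> \<turnstile>c d : B \<Rightarrow> D \<Longrightarrow>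
    \<Gamma> \<turnstile> Cast V (CPlus c d) \<longrightarrow>\<^sub>r
      Case V (Lam A (InL D (Cast (Var 0) c))) (Lam B (InR C (Cast (Var 0) d)))"
| r_beta: "val V \<Longrightarrow> \<Gamma> \<turnstile> App (Lam A M) V \<longrightarrow>\<^sub>r subst0 M V"
| r_ite_true: "\<Gamma> \<turnstile> Ite (Const (PBase BBool) (BaseV (BoolV True))) M N \<longrightarrow>\<^sub>r M"
| r_ite_false: "\<Gamma> \<turnstile> Ite (Const (PBase BBool) (BaseV (BoolV False))) M N \<longrightarrow>\<^sub>r N"
| r_fst: "val V \<Longrightarrow> val W \<Longrightarrow> \<Gamma> \<turnstile> Fst (MkPair V W) \<longrightarrow>\<^sub>r V"
| r_snd: "val V \<Longrightarrow> val W \<Longrightarrow> \<Gamma> \<turnstile> Snd (MkPair V W) \<longrightarrow>\<^sub>r W"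
| r_case_inl: "val V \<Longrightarrow> \<Gamma> \<turnstile> Case (InL B V) L M \<longrightarrow>\<^sub>r App L V"
| r_case_inr: "val V \<Longrightarrow> \<Gamma> \<turnstile> Case (InR A V) L M \<longrightarrow>\<^sub>r App M V"
| r_delta: "\<Gamma> \<turnstile> App (Const (PArr b P) (FunV f)) (Const (PBase b) (BaseV v)) \<longrightarrow>\<^sub>r Const P (f v)"

end

theory Submission
  imports Defs
begin

text \<open>Each redex gets a well-typed reduct as it is exhibited, so a single induction on the typing
  derivation suffices and preservation is not needed separately. A non-value subterm in evaluation position steps or is blame, and then a frame
  steps; otherwise canonical forms expose a redex. At type \<open>?\<close> the only values are injections, which
  is what unblocks projections; no constant inhabits the empty base type, a product, a sum or \<open>?\<close>.\<close>

section \<open>Inversion rules, and typing of renaming, substitution and plugging\<close>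

inductive_cases coercion_typingE:
  "\<turnstile>c Fail A' B' l : A \<Rightarrow> B"
  "\<turnstile>c CId a : A \<Rightarrow> B"
  "\<turnstile>c Inj A' : A \<Rightarrow> B"
  "\<turnstile>c Proj B' l : A \<Rightarrow> B"
  "\<turnstile>c CArr c d : A \<Rightarrow> B"
  "\<turnstile>c CTimes c d : A \<Rightarrow> B"
  "\<turnstile>c CPlus c d : A \<Rightarrow> B"

inductive_cases typingE:
  "\<Gamma> \<turnstile> Const P k : A"
  "\<Gamma> \<turnstile> Lam B M : A"
  "\<Gamma> \<turnstile> MkPair M N : A"
  "\<Gamma> \<turnstile> InL B M : A"
  "\<Gamma> \<turnstile> InR B M : A"
  "\<Gamma> \<turnstile> Cast M c : A"

text \<open>Both \<open>\<rho>\<close> and \<open>\<Delta>\<close> vary in the induction because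
  passing under \<open>Lam\<close> extends them. Renamings come before substitutions since
  \<open>ext_sub\<close> weakens the substituted terms.\<close>

lemma rename_typing:
  assumes "\<Gamma> \<turnstile> M : A"
    and "\<And>x. x < length \<Gamma> \<Longrightarrow> \<rho> x < length \<Delta> \<and> \<Delta> ! \<rho> x = \<Gamma> ! x"
  shows "\<Delta> \<turnstile> rename \<rho> M : A"
  using assms
proof (induction arbitrary: \<Delta> \<rho> rule: typing.induct)
  case (t_Lam B \<Gamma> M C)
  have "B # \<Delta> \<turnstile> rename (ext_ren \<rho>) M : C"
    using t_Lam.prems by (intro t_Lam.IH) (auto simp: ext_ren_def split: nat.split)
  then show ?case by (simp add: typing.t_Lam)
qed (simp_all, (blast intro: typing.intros)+)

lemma weaken_typing: "\<Gamma> \<turnstile> M : A \<Longrightarrow> B # \<Gamma> \<turnstile> weaken M : A"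
  by (rule rename_typing) auto

lemma subst_typing:
  assumes "\<Gamma> \<turnstile> M : A"
    and "\<And>x. x < length \<Gamma> \<Longrightarrow> \<Delta> \<turnstile> \<sigma> x : \<Gamma> ! x"
  shows "\<Delta> \<turnstile> subst \<sigma> M : A"
  using assms
proof (induction arbitrary: \<Delta> \<sigma> rule: typing.induct)
  case (t_Lam B \<Gamma> M C)
  have "B # \<Delta> \<turnstile> subst (ext_sub \<sigma>) M : C"
    using t_Lam.prems
    by (intro t_Lam.IH) (auto simp: ext_sub_def intro: typing.t_Var weaken_typing split: nat.split)
  then show ?case by (simp add: typing.t_Lam)
qed (simp_all, (blast intro: typing.intros)+)

lemma subst0_typing:
  assumes "B # \<Gamma> \<turnstile> M : A" and "\<Gamma> \<turnstile> V : B"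
  shows "\<Gamma> \<turnstile> subst0 M V : A"
  unfolding subst0_def using assms
  by (intro subst_typing[OF assms(1)]) (auto intro: typing.t_Var split: nat.split)

lemma plug_typing: "\<Gamma> \<turnstile>f F : A \<Rightarrow> B \<Longrightarrow> \<Gamma> \<turnstile> M : A \<Longrightarrow> \<Gamma> \<turnstile> plug F M : B"
  by (induction rule: frame_typing.induct) (auto intro: typing.intros)

section \<open>Canonical forms of values\<close>

lemma not_eq_ty_of_pty [simp]:
  "Dyn \<noteq> ty_of_pty P" "Times A B \<noteq> ty_of_pty P" "Plus A B \<noteq> ty_of_pty P"
  by (cases P; simp)+

lemma Base_eq_ty_of_pty: "Base b = ty_of_pty P \<longleftrightarrow> P = PBase b"
  by (cases P) auto

lemma Arr_eq_ty_of_pty: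
  "Arr A B = ty_of_pty P \<longleftrightarrow> (\<exists>b Q. P = PArr b Q \<and> A = Base b \<and> B = ty_of_pty Q)"
  by (cases P) auto

text \<open>Variables are not values, so this and the other canonical forms hold in every context.
  Of the value forms, only an injection can have target \<open>Dyn\<close>.\<close>

lemma canonical_Dyn:
  assumes "val V" and "\<Gamma> \<turnstile> V : Dyn"
  obtains W A where "V = Cast W (Inj A)" "val W" "\<Gamma> \<turnstile> W : A"
  using assms by (cases rule: val.cases) (auto elim!: typingE coercion_typingE)

text \<open>The membership in \<open>den_base b\<close> rules out \<open>BVoid\<close>, and it later
  supplies the Boolean of a conditional and the argument of a primitive function.\<close>

lemma canonical_Base:
  assumes "val V" and "\<Gamma> \<turnstile> V : Base b"
  obtains v where "V = Const (PBase b) (BaseV v)" "v \<in> den_base b"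
  using assms
  by (cases rule: val.cases) (auto elim!: typingE coercion_typingE simp: Base_eq_ty_of_pty)

text \<open>A cast by \<open>CArr\<close> is active, so no value is a function wrapped in a cast:
  only abstractions and primitive functions remain.\<close>

lemma canonical_Arr:
  assumes "val V" and "\<Gamma> \<turnstile> V : Arr A B"
  obtains (Lam) M where "V = Lam A M" "A # \<Gamma> \<turnstile> M : B"
    | (Const) b P f where "V = Const (PArr b P) (FunV f)" "f \<in> den_base b \<rightarrow>\<^sub>E den_pty P"
        "A = Base b" "B = ty_of_pty P"
  using assms
  by (cases rule: val.cases)
    (auto elim!: typingE coercion_typingE simp: Arr_eq_ty_of_pty)

lemma canonical_Times:
  assumes "val V" and "\<Gamma> \<turnstile> V : Times A B"
  obtains V1 V2 where "V = MkPair V1 V2" "val V1" "val V2" "\<Gamma> \<turnstile> V1 : A" "\<Gamma> \<turnstile> V2 : B"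
  using assms by (cases rule: val.cases) (auto elim!: typingE coercion_typingE)

lemma canonical_Plus:
  assumes "val V" and "\<Gamma> \<turnstile> V : Plus A B"
  obtains (InL) W where "V = InL B W" "val W" "\<Gamma> \<turnstile> W : A"
    | (InR) W where "V = InR A W" "val W" "\<Gamma> \<turnstile> W : B"
  using assms by (cases rule: val.cases) (auto elim!: typingE coercion_typingE)

section \<open>Steps with typed reducts: frames, applications and casts\<close>

definition steps :: "ctx \<Rightarrow> 'l :: blame_label tm \<Rightarrow> ty \<Rightarrow> bool" where
  "steps \<Gamma> M A \<longleftrightarrow> (\<exists>M'. \<Gamma> \<turnstile> M' : A \<and> \<Gamma> \<turnstile> M \<longrightarrow>\<^sub>r M')"

lemma stepsI: "\<Gamma> \<turnstile> M \<longrightarrow>\<^sub>r M' \<Longrightarrow> \<Gamma> \<turnstile> M' : A \<Longrightarrow> steps \<Gamma> M A"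
  by (auto simp: steps_def)

text \<open>The first assumption has the shape of the induction hypothesis of progress. Once values
  are excluded, a step is lifted by \<open>r_frame\<close> and typed by \<open>plug_typing\<close>,
  while blame is propagated by \<open>r_blame\<close>.\<close>

lemma steps_plug:
  assumes "steps \<Gamma> M A \<or> val M \<or> (\<exists>l. M = Blame A l)" and "\<not> val M" and "\<Gamma> \<turnstile>f F : A \<Rightarrow> B"
  shows "steps \<Gamma> (plug F M) B"
  using assms unfolding steps_def
  by (metis plug_typing r_frame r_blame t_Blame)

lemma App_steps:
  assumes "val V" and "val W" and "\<Gamma> \<turnstile> V : Arr A B" and "\<Gamma> \<turnstile> W : A"
  shows "steps \<Gamma> (App V W) B"
  using assms(1,3)
proof (cases rule: canonical_Arr)
  case (Lam M)
  with assms show ?thesis by (auto intro: stepsI r_beta subst0_typing)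
next
  case (Const b P f)
  with assms obtain v where v: "W = Const (PBase b) (BaseV v)" "v \<in> den_base b"
    using canonical_Base by blast
  \<comment> \<open>Membership of \<open>f\<close> in the function set puts \<open>f v\<close> into
    \<open>den_pty P\<close>, which makes the result a well-typed constant.\<close>
  with Const have "\<Gamma> \<turnstile> Const P (f v) : B" by (auto intro: t_Const)
  with Const v show ?thesis by (auto intro: stepsI r_delta)
qed

text \<open>Each active coercion has its own reduction rule, and \<open>Inj\<close>, the only inert
  one, yields a value.\<close>

lemma Cast_progress:
  assumes V: "val V" "\<Gamma> \<turnstile> V : A" and c: "\<turnstile>c c : A \<Rightarrow> B"
  shows "steps \<Gamma> (Cast V c) B \<or> val (Cast V c)"
  using c
proof cases
  case (ct_Fail l)
  with V show ?thesis by (auto intro: stepsI r_fail t_Blame)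
next
  case ct_Id
  with V show ?thesis by (auto intro: stepsI r_id)
next
  case ct_Inj
  with V show ?thesis by (auto intro: v_Inj)
next
  case (ct_Proj l)
  from V ct_Proj obtain W C where "V = Cast W (Inj C)" "val W" "\<Gamma> \<turnstile> W : C"
    using canonical_Dyn by blast
  \<comment> \<open>\<open>coerce\<close> is total and well typed, returning a failure for types
    that are not shallowly consistent, so no consistency test is needed here.\<close>
  with ct_Proj show ?thesis by (auto intro: stepsI r_proj t_Cast coerce_typing)
next
  case (ct_Arr c1 C A' d B' D)
  have "C # \<Gamma> \<turnstile> weaken V : Arr A' B'"
    using V ct_Arr by (auto intro: weaken_typing)
  moreover have "C # \<Gamma> \<turnstile> Var 0 : C"
    by (simp add: t_Var)
  ultimately have "\<Gamma> \<turnstile> Lam C (Cast (App (weaken V) (Cast (Var 0) c1)) d) : B"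
    using ct_Arr by (auto intro!: typing.t_Lam typing.t_Cast typing.t_App)
  with ct_Arr V show ?thesis by (auto intro: stepsI r_arr)
next
  case (ct_Times c1 A' C d B' D)
  with V have "\<Gamma> \<turnstile> MkPair (Cast (Fst V) c1) (Cast (Snd V) d) : B"
    by (auto intro: typing.intros)
  with ct_Times V show ?thesis by (auto intro: stepsI r_times)
next
  case (ct_Plus c1 A' C d B' D)
  \<comment> \<open>Stated for all \<open>X\<close> because the two branches bind variables of the
    different types \<open>A'\<close> and \<open>B'\<close>.\<close>
  have "X # \<Gamma> \<turnstile> Var 0 : X" for X
    by (simp add: t_Var)
  with ct_Plus V
  have "\<Gamma> \<turnstile> Case V (Lam A' (InL D (Cast (Var 0) c1))) (Lam B' (InR C (Cast (Var 0) d))) : B"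
    by (auto intro!: t_Case t_Lam t_InL t_InR intro: t_Cast)
  with ct_Plus V show ?thesis by (auto intro: stepsI r_plus)
qed

text \<open>All subterms that must be evaluated share the context \<open>[]\<close>, so the
  induction can keep it fixed; the body of an abstraction lives in a larger context, but the
  abstraction is already a value.\<close>

lemma progress:
  fixes M :: "'l :: blame_label tm"
  assumes "[] \<turnstile> M : A"
  shows "steps [] M A \<or> val M \<or> (\<exists>l. M = Blame A l)"
  using assms
proof (induction "[] :: ctx" M A rule: typing.induct)
  case (t_App L A B M)
  show ?case
  proof (cases "val L")
    case L: True
    show ?thesis
    proof (cases "val M")
      case True
      with L t_App show ?thesis by (blast intro: App_steps)
    next
      case False
      with L t_App show ?thesis
        \<comment> \<open>This frame is legal because \<open>L\<close> is already a value:
          evaluation goes from left to right.\<close>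
        using steps_plug[of "[]" M A "FAppR L" B] by (auto intro: frame_typing.intros)
    qed
  next
    case False
    with t_App show ?thesis
      using steps_plug[of "[]" L "Arr A B" "FAppL M" B] by (auto intro: frame_typing.intros)
  qed
next
  case (t_Ite L M B N)
  show ?case
  proof (cases "val L")
    case True
    with t_Ite(1) obtain v where "L = Const (PBase BBool) (BaseV v)" "v \<in> den_base BBool"
      using canonical_Base by blast
    then obtain t where L: "L = Const (PBase BBool) (BaseV (BoolV t))"
      by auto
    have "steps [] (Ite L M N) B"
    proof (cases t)
      case True
      with L t_Ite(3) show ?thesis by (simp add: stepsI[OF r_ite_true])
    next
      case False
      with L t_Ite(5) show ?thesis by (simp add: stepsI[OF r_ite_false])
    qed
    then show ?thesis ..
  next
    case False
    with t_Ite show ?thesis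
      using steps_plug[of "[]" L "Base BBool" "FIte M N" B] by (auto intro: frame_typing.intros)
  qed
next
  case (t_MkPair M A N B)
  show ?case
  proof (cases "val M")
    case M: True
    show ?thesis
    proof (cases "val N")
      case True
      with M show ?thesis by (simp add: v_MkPair)
    next
      case False
      with M t_MkPair show ?thesis
        using steps_plug[of "[]" N B "FMkPairR M" "Times A B"] by (auto intro: frame_typing.intros)
    qed
  next
    case False
    with t_MkPair show ?thesis
      using steps_plug[of "[]" M A "FMkPairL N" "Times A B"] by (auto intro: frame_typing.intros)
  qed
next
  case (t_Fst M A B)
  show ?case
  proof (cases "val M")
    case True
    with t_Fst show ?thesis by (metis canonical_Times stepsI r_fst)
  next
    case False
    with t_Fst show ?thesis
      using steps_plug[of "[]" M "Times A B" FFst A] by (auto intro: frame_typing.intros)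
  qed
next
  case (t_Snd M A B)
  show ?case
  proof (cases "val M")
    case True
    with t_Snd show ?thesis by (metis canonical_Times stepsI r_snd)
  next
    case False
    with t_Snd show ?thesis
      using steps_plug[of "[]" M "Times A B" FSnd B] by (auto intro: frame_typing.intros)
  qed
next
  case (t_InL M A B)
  then show ?case
    using steps_plug[of "[]" M A "FInL B" "Plus A B"] by (auto intro: frame_typing.intros v_InL)
next
  case (t_InR M B A)
  then show ?case
    using steps_plug[of "[]" M B "FInR A" "Plus A B"] by (auto intro: frame_typing.intros v_InR)
next
  case (t_Case L A1 A2 M B N)
  show ?case
  proof (cases "val L")
    case True
    from True t_Case(1) have "steps [] (Case L M N) B"
    proof (cases rule: canonical_Plus)
      case (InL W)
      \<comment> \<open>The branches are terms of function type, so the reduct applies one of them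
        to the payload without first evaluating it.\<close>
      with t_Case show ?thesis by (auto intro: stepsI r_case_inl typing.t_App)
    next
      case (InR W)
      with t_Case show ?thesis by (auto intro: stepsI r_case_inr typing.t_App)
    qed
    then show ?thesis ..
  next
    case False
    with t_Case show ?thesis
      using steps_plug[of "[]" L "Plus A1 A2" "FCase M N" B] by (auto intro: frame_typing.intros)
  qed
next
  case (t_Cast M A c B)
  show ?case
  proof (cases "val M")
    case True
    with t_Cast show ?thesis by (blast dest: Cast_progress)
  next
    case False
    with t_Cast show ?thesis
      using steps_plug[of "[]" M A "FCast c" B] by (auto intro: frame_typing.intros)
  qed
\<comment> \<open>What remains are constants and abstractions, which are values, variables, for
  which \<open>[]\<close> has no index, and blame itself.\<close>
qed (auto intro: val.intros)

theorem corollary91: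
  fixes M :: "'l :: blame_label tm" and A :: ty
  assumes "[] \<turnstile> M : A"
  shows "(\<exists>M'. [] \<turnstile> M' : A \<and> [] \<turnstile> M \<longrightarrow>\<^sub>r M') \<or> val M \<or> (\<exists>l. M = Blame A l)"
  using progress[OF assms] by (simp add: steps_def)

end
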